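(* Let $R$ be a superring. A pair $(A,\mathfrak p)$ (with $A$ a subsuperring of $R$ and $\mathfrak p$ a prime ideal of $A$ containing $\mathfrak J_R$) is a valuation pair of $R$ if and only if it is a maximal pair of $R$.
   Context: A superring is a $\mathbb Z/2$-graded unital ring $R=R_{\overline 0}\oplus R_{\overline 1}$ with $1\neq 0$, assumed supercommutative: $R_{\overline 0}$ is central in $R$ and every element of $R_{\overline 1}$ squares to zero. A subsuperring $A\subseteq R$ is a subring with the same unit and compatible grading ($A_i=A\cap R_i$). An ideal $\mathfrak p$ of a superring $A$ is prime if $A/\mathfrak p$ is an integral domain; any prime ideal is graded and contains $A_{\overline 1}$; write $\mathfrak p_{\overline 0}=\mathfrak p\cap A_{\overline 0}$. Put $\mathfrak J_R=R\cdot R_{\overline 1}=R_{\overline 1}^2\oplus R_{\overline 1}$. A valuation pair of $R$ is a pair $(A,\mathfrak p)$ such that: (i) $A$ is a subsuperring of $R$ and $\mathfrak p$ is a prime ideal of $A$ containing $\mathfrak J_R$; (ii) for every $x\in R\setminus A$ there exists $x'\in\mathfrak p_{\overline 0}$ with $xx'\in A\setminus\mathfrak p$. Let $\mathcal C$ be the set of pairs $(A,\mathfrak p)$ with $A$ a subsuperring of $R$ and $\mathfrak p$ a prime ideal of $A$ containing $\mathfrak J_R$, partially ordered by $(A,\mathfrak p)\preceq(B,\mathfrak q)$ if $A\subseteq B$ and $\mathfrak p=A\cap\mathfrak q$. A maximal pair is a $\preceq$-maximal element of $\mathcal C$. *)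

theory Defs
  imports "HOL-Algebra.Algebra"
begin

text \<open>The \<open>\<int>/2\<close>-grading of a ring \<open>R\<close> is given by its even part \<open>E\<close> and its odd part \<open>D\<close>.
  That \<open>\<one>\<close> is even follows from the axioms.\<close>

locale superring = ring R for R (structure) +
  fixes E D :: "'a set"
  assumes even_additive_subgroup: "additive_subgroup E R"
    and odd_additive_subgroup: "additive_subgroup D R"
    and grading_sum: "E <+> D = carrier R"
    and grading_direct: "E \<inter> D = {\<zero>}"
    and even_even: "\<lbrakk> x \<in> E; y \<in> E \<rbrakk> \<Longrightarrow> x \<otimes> y \<in> E"
    and even_odd: "\<lbrakk> x \<in> E; y \<in> D \<rbrakk> \<Longrightarrow> x \<otimes> y \<in> D"
    and odd_even: "\<lbrakk> x \<in> D; y \<in> E \<rbrakk> \<Longrightarrow> x \<otimes> y \<in> D"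
    and odd_odd: "\<lbrakk> x \<in> D; y \<in> D \<rbrakk> \<Longrightarrow> x \<otimes> y \<in> E"
    and one_not_zero: "\<one> \<noteq> \<zero>"
    and even_central: "\<lbrakk> x \<in> E; y \<in> carrier R \<rbrakk> \<Longrightarrow> x \<otimes> y = y \<otimes> x"
    and odd_square: "x \<in> D \<Longrightarrow> x \<otimes> x = \<zero>"

definition subsuperring :: "('a, 'b) ring_scheme \<Rightarrow> 'a set \<Rightarrow> 'a set \<Rightarrow> 'a set \<Rightarrow> bool" where
  "subsuperring R E D A \<longleftrightarrow> subring A R \<and> A = (A \<inter> E) <+>\<^bsub>R\<^esub> (A \<inter> D)"

text \<open>The library's \<open>primeideal\<close> is restricted to commutative rings, which a superring need
  not be.\<close>

definition prime_ideal_of :: "('a, 'b) ring_scheme \<Rightarrow> 'a set \<Rightarrow> 'a set \<Rightarrow> bool" where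
  "prime_ideal_of R A p \<longleftrightarrow>
     ideal p (R\<lparr>carrier := A\<rparr>) \<and> domain ((R\<lparr>carrier := A\<rparr>) Quot p)"

text \<open>\<open>ideal_prod\<close> consists of the finite sums of products, also when, as for \<open>D\<close> here,
  a factor is not an ideal.\<close>

definition odd_ideal :: "('a, 'b) ring_scheme \<Rightarrow> 'a set \<Rightarrow> 'a set" where
  "odd_ideal R D = ideal_prod R (carrier R) D"

definition superring_pair ::
    "('a, 'b) ring_scheme \<Rightarrow> 'a set \<Rightarrow> 'a set \<Rightarrow> 'a set \<Rightarrow> 'a set \<Rightarrow> bool" where
  "superring_pair R E D A p \<longleftrightarrow>
     subsuperring R E D A \<and> prime_ideal_of R A p \<and> odd_ideal R D \<subseteq> p"

definition valuation_pair ::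
    "('a, 'b) ring_scheme \<Rightarrow> 'a set \<Rightarrow> 'a set \<Rightarrow> 'a set \<Rightarrow> 'a set \<Rightarrow> bool" where
  "valuation_pair R E D A p \<longleftrightarrow>
     superring_pair R E D A p \<and>
     (\<forall>x \<in> carrier R - A. \<exists>x' \<in> p \<inter> (A \<inter> E). x \<otimes>\<^bsub>R\<^esub> x' \<in> A - p)"

definition pair_le :: "'a set \<Rightarrow> 'a set \<Rightarrow> 'a set \<Rightarrow> 'a set \<Rightarrow> bool" where
  "pair_le A p B q \<longleftrightarrow> A \<subseteq> B \<and> p = A \<inter> q"

definition maximal_pair ::
    "('a, 'b) ring_scheme \<Rightarrow> 'a set \<Rightarrow> 'a set \<Rightarrow> 'a set \<Rightarrow> 'a set \<Rightarrow> bool" where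
  "maximal_pair R E D A p \<longleftrightarrow>
     superring_pair R E D A p \<and>
     (\<forall>B q. superring_pair R E D B q \<longrightarrow> pair_le A p B q \<longrightarrow> B = A \<and> q = p)"

end

theory Submission
  imports Defs
begin

text \<open>
  An element \<open>x\<close> of a larger pair \<open>(B, q)\<close> lying outside \<open>A\<close> cannot satisfy the valuation
  condition: a multiplier \<open>x' \<in> p \<subseteq> q\<close> would put \<open>x x'\<close> into \<open>q \<inter> A = p\<close>. So valuation pairs are
  maximal (\<open>valuation_imp_maximal\<close>).

  For the converse, the odd part \<open>D\<close> lies in \<open>p\<close> for every pair, so a pair is determined by its even
  part: \<open>A = (A \<inter> E) + D\<close> and \<open>p = (p \<inter> E) + D\<close>. Conversely, if \<open>B\<close> is a subring of the commutative
  ring \<open>E\<close> and \<open>q\<close> a prime ideal of \<open>B\<close> containing all products of two odd elements, then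
  \<open>(B + D, q + D)\<close> is a pair of \<open>R\<close> (\<open>superring_pair_even_plus_odd\<close>). Hence the even part of a
  maximal pair is maximal among the pairs of \<open>E\<close>, and it is enough to prove the valuation condition
  for maximal pairs of a commutative ring, a theorem of Manis.

  In the commutative case let \<open>x\<close> lie outside \<open>A\<close>. The ideal \<open>p A[x]\<close> of \<open>A[x]\<close> meets \<open>A - p\<close>: otherwise
  Zorn's lemma gives a prime ideal of \<open>A[x]\<close> that contains \<open>p A[x]\<close> and avoids \<open>A - p\<close>, against
  maximality (\<open>extended_ideal_meets_complement\<close>). Choose a relation
  \<open>s = a\<^sub>m x^m + \<dots> + a\<^sub>0\<close> with \<open>s \<in> A - p\<close>, all \<open>a\<^sub>i \<in> p\<close>, and \<open>m\<close> minimal. Multiplied by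
  \<open>a\<^sub>m ^ (m - 1)\<close> it becomes an equation of integral dependence for \<open>z = a\<^sub>m x\<close> over \<open>A\<close>. Since \<open>A\<close> is
  integrally closed (\<open>integrally_closed\<close>, again from maximality, by a Nakayama argument),
  \<open>z \<in> A\<close>. Were \<open>z\<close> in \<open>p\<close>, the two leading terms would combine to \<open>(z + a\<^sub>m\<^sub>-\<^sub>1) x^(m-1)\<close>,
  contradicting minimality. So \<open>x a\<^sub>m \<in> A - p\<close> with \<open>a\<^sub>m \<in> p\<close>.
\<close>

section \<open>Prime ideals of subrings, elementwise\<close>

lemma (in ring) a_inv_restrict_subring:
  assumes "subring A R" "a \<in> A"
  shows "\<ominus>\<^bsub>R\<lparr>carrier := A\<rparr>\<^esub> a = \<ominus> a"
proof -
  interpret A: ring "R\<lparr>carrier := A\<rparr>" using subring_is_ring[OF assms(1)] .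
  have c: "a \<in> carrier R" "A \<subseteq> carrier R" using assms subringE(1)[OF assms(1)] by auto
  have "\<ominus>\<^bsub>R\<lparr>carrier := A\<rparr>\<^esub> a \<in> A" using A.a_inv_closed[of a] assms(2) by simp
  moreover have "\<ominus>\<^bsub>R\<lparr>carrier := A\<rparr>\<^esub> a \<oplus> a = \<zero>" using A.l_neg[of a] assms(2) by simp
  ultimately show ?thesis using minus_equality[of "\<ominus>\<^bsub>R\<lparr>carrier := A\<rparr>\<^esub> a" a] c by auto
qed

lemma (in ring) ideal_of_subring_iff:
  assumes A: "subring A R"
  shows "ideal I (R\<lparr>carrier := A\<rparr>) \<longleftrightarrow>
    I \<subseteq> A \<and> \<zero> \<in> I \<and> (\<forall>x\<in>I. \<forall>y\<in>I. x \<oplus> y \<in> I) \<and> (\<forall>a\<in>A. \<forall>x\<in>I. a \<otimes> x \<in> I \<and> x \<otimes> a \<in> I)"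
    (is "?L \<longleftrightarrow> ?R")
proof
  assume ?L
  then have I: "ideal I (R\<lparr>carrier := A\<rparr>)" .
  note sub = ideal.axioms(1)[OF I]
  show ?R
  proof (intro conjI ballI)
    show "I \<subseteq> A" using additive_subgroup.a_subset[OF sub] by simp
    show "\<zero> \<in> I" using additive_subgroup.zero_closed[OF sub] by simp
    show "x \<oplus> y \<in> I" if "x \<in> I" "y \<in> I" for x y
      using additive_subgroup.a_closed[OF sub that] by simp
    show "a \<otimes> x \<in> I" "x \<otimes> a \<in> I" if "a \<in> A" "x \<in> I" for a x
      using ideal.I_l_closed[OF I that(2), of a] ideal.I_r_closed[OF I that(2), of a] that(1)
      by simp_all
  qed
next
  assume I: ?R
  interpret A: ring "R\<lparr>carrier := A\<rparr>" using subring_is_ring[OF A] .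
  have neg: "\<ominus> x \<in> I" if "x \<in> I" for x
  proof -
    have "\<ominus> x = \<ominus> \<one> \<otimes> x" using that I subringE(1)[OF A] by (auto simp: l_minus)
    thus ?thesis using I that subringE(3,5)[OF A] by auto
  qed
  show ?L
  proof (rule idealI[OF A.ring_axioms])
    show "subgroup I (add_monoid (R\<lparr>carrier := A\<rparr>))"
    proof (rule A.add.subgroupI)
      show "I \<subseteq> carrier (R\<lparr>carrier := A\<rparr>)" "I \<noteq> {}" using I by auto
      fix x assume "x \<in> I"
      thus "\<ominus>\<^bsub>R\<lparr>carrier := A\<rparr>\<^esub> x \<in> I"
        using neg a_inv_restrict_subring[OF A] I by auto
    next
      fix x y assume "x \<in> I" "y \<in> I"
      thus "x \<oplus>\<^bsub>R\<lparr>carrier := A\<rparr>\<^esub> y \<in> I" using I by auto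
    qed
  qed (use I in auto)
qed

text \<open>In a noncommutative ring, commutativity of the quotient is a condition of its own: the ideal
  has to contain the commutators.\<close>

lemma (in ring) domain_Quot_iff:
  assumes I: "ideal I R"
  shows "domain (R Quot I) \<longleftrightarrow> \<one> \<notin> I \<and>
    (\<forall>a\<in>carrier R. \<forall>b\<in>carrier R. a \<otimes> b \<in> I \<longrightarrow> a \<in> I \<or> b \<in> I) \<and>
    (\<forall>a\<in>carrier R. \<forall>b\<in>carrier R. a \<otimes> b \<ominus> b \<otimes> a \<in> I)"
    (is "?L \<longleftrightarrow> ?R")
proof -
  interpret ideal I R by fact
  interpret Q: ring "R Quot I" by (rule quotient_is_ring)
  have coset_zero: "I +> a = \<zero>\<^bsub>R Quot I\<^esub> \<longleftrightarrow> a \<in> I" if "a \<in> carrier R" for a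
    using that rcos_const_imp_mem a_rcos_const by (auto simp: FactRing_def)
  have coset_mult: "(I +> a) \<otimes>\<^bsub>R Quot I\<^esub> (I +> b) = I +> (a \<otimes> b)"
    if "a \<in> carrier R" "b \<in> carrier R" for a b
    using that rcoset_mult_add by (simp add: FactRing_def)
  have coset_one: "\<one>\<^bsub>R Quot I\<^esub> = I +> \<one>" by (simp add: FactRing_def)
  have coset_carrier: "carrier (R Quot I) = {I +> a | a. a \<in> carrier R}"
    by (auto simp: FactRing_simps)
  have comm: "a \<otimes> b \<ominus> b \<otimes> a \<in> I \<longleftrightarrow>
      (I +> a) \<otimes>\<^bsub>R Quot I\<^esub> (I +> b) = (I +> b) \<otimes>\<^bsub>R Quot I\<^esub> (I +> a)"
    if "a \<in> carrier R" "b \<in> carrier R" for a b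
    using that coset_mult quotient_eq_iff_same_a_r_cos[OF I, of "a \<otimes> b" "b \<otimes> a"] by simp
  show ?thesis
  proof
    assume ?L
    then interpret D: domain "R Quot I" .
    show ?R
    proof (intro conjI ballI impI)
      show "\<one> \<notin> I" using D.one_not_zero coset_zero coset_one by auto
      fix a b assume ab: "a \<in> carrier R" "b \<in> carrier R"
      have c: "I +> a \<in> carrier (R Quot I)" "I +> b \<in> carrier (R Quot I)"
        using ab coset_carrier by auto
      show "a \<otimes> b \<ominus> b \<otimes> a \<in> I" using comm ab D.m_comm[OF c] by simp
      assume "a \<otimes> b \<in> I"
      thus "a \<in> I \<or> b \<in> I"
        using D.integral[OF _ c] coset_mult coset_zero ab by auto
    qed
  next
    assume r: ?R
    show ?L
    proof (intro domain.intro cring.intro domain_axioms.intro)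
      show "ring (R Quot I)" by (rule Q.ring_axioms)
      show "comm_monoid (R Quot I)"
        by (rule Q.monoid_comm_monoidI) (use r comm coset_carrier in auto)
      show "\<one>\<^bsub>R Quot I\<^esub> \<noteq> \<zero>\<^bsub>R Quot I\<^esub>" using r coset_zero coset_one by auto
      fix u v
      assume uv: "u \<otimes>\<^bsub>R Quot I\<^esub> v = \<zero>\<^bsub>R Quot I\<^esub>" "u \<in> carrier (R Quot I)" "v \<in> carrier (R Quot I)"
      then obtain a b where ab: "a \<in> carrier R" "b \<in> carrier R" "u = I +> a" "v = I +> b"
        unfolding coset_carrier by auto
      hence "a \<otimes> b \<in> I" using uv(1) coset_mult[OF ab(1,2)] coset_zero[OF m_closed[OF ab(1,2)]] by simp
      thus "u = \<zero>\<^bsub>R Quot I\<^esub> \<or> v = \<zero>\<^bsub>R Quot I\<^esub>"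
        using r ab coset_zero[OF ab(1)] coset_zero[OF ab(2)] by auto
    qed
  qed
qed

lemma (in ring) prime_ideal_of_iff:
  assumes A: "subring A R"
  shows "prime_ideal_of R A p \<longleftrightarrow>
    p \<subseteq> A \<and> \<zero> \<in> p \<and> (\<forall>x\<in>p. \<forall>y\<in>p. x \<oplus> y \<in> p) \<and>
    (\<forall>a\<in>A. \<forall>x\<in>p. a \<otimes> x \<in> p \<and> x \<otimes> a \<in> p) \<and> \<one> \<notin> p \<and>
    (\<forall>a\<in>A. \<forall>b\<in>A. a \<otimes> b \<in> p \<longrightarrow> a \<in> p \<or> b \<in> p) \<and>
    (\<forall>a\<in>A. \<forall>b\<in>A. a \<otimes> b \<ominus> b \<otimes> a \<in> p)"
proof -
  interpret A: ring "R\<lparr>carrier := A\<rparr>" using subring_is_ring[OF A] .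
  have minus: "a \<ominus>\<^bsub>R\<lparr>carrier := A\<rparr>\<^esub> b = a \<ominus> b" if "b \<in> A" for a b
    using that a_inv_restrict_subring[OF A] by (simp add: a_minus_def)
  have "prime_ideal_of R A p \<longleftrightarrow> ideal p (R\<lparr>carrier := A\<rparr>) \<and> \<one> \<notin> p \<and>
    (\<forall>a\<in>A. \<forall>b\<in>A. a \<otimes> b \<in> p \<longrightarrow> a \<in> p \<or> b \<in> p) \<and>
    (\<forall>a\<in>A. \<forall>b\<in>A. a \<otimes> b \<ominus> b \<otimes> a \<in> p)"
    unfolding prime_ideal_of_def using A.domain_Quot_iff[of p] minus subringE(6)[OF A]
    by auto
  thus ?thesis unfolding ideal_of_subring_iff[OF A] by auto
qed

lemma (in ring) prime_ideal_ofD: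
  assumes A: "subring A R" and p: "prime_ideal_of R A p"
  shows "p \<subseteq> A" "\<zero> \<in> p" "\<one> \<notin> p"
    and "x \<in> p \<Longrightarrow> y \<in> p \<Longrightarrow> x \<oplus> y \<in> p"
    and "a \<in> A \<Longrightarrow> x \<in> p \<Longrightarrow> a \<otimes> x \<in> p"
    and "x \<in> p \<Longrightarrow> a \<in> A \<Longrightarrow> x \<otimes> a \<in> p"
    and "a \<in> A \<Longrightarrow> b \<in> A \<Longrightarrow> a \<otimes> b \<in> p \<Longrightarrow> a \<in> p \<or> b \<in> p"
    and "x \<in> p \<Longrightarrow> \<ominus> x \<in> p"
    and "a \<in> A \<Longrightarrow> b \<in> A \<Longrightarrow> a \<otimes> b \<ominus> b \<otimes> a \<in> p"
proof -
  note pp = p[unfolded prime_ideal_of_iff[OF A]]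
  show pA: "p \<subseteq> A" and "\<zero> \<in> p" "\<one> \<notin> p"
    and "x \<in> p \<Longrightarrow> y \<in> p \<Longrightarrow> x \<oplus> y \<in> p"
    and "x \<in> p \<Longrightarrow> a \<in> A \<Longrightarrow> x \<otimes> a \<in> p"
    and "a \<in> A \<Longrightarrow> b \<in> A \<Longrightarrow> a \<otimes> b \<in> p \<Longrightarrow> a \<in> p \<or> b \<in> p"
    and "a \<in> A \<Longrightarrow> b \<in> A \<Longrightarrow> a \<otimes> b \<ominus> b \<otimes> a \<in> p"
    using pp by blast+
  show mult: "a \<in> A \<Longrightarrow> x \<in> p \<Longrightarrow> a \<otimes> x \<in> p" for a x using pp by blast
  assume x: "x \<in> p"
  have "\<ominus> x = \<ominus> \<one> \<otimes> x" using x pA subringE(1)[OF A] by (auto simp: l_minus)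
  thus "\<ominus> x \<in> p" using mult[OF subringE(5)[OF A subringE(3)[OF A]] x] by simp
qed

lemma primeideal_imp_prime_ideal_of:
  assumes "primeideal q (R\<lparr>carrier := B\<rparr>)"
  shows "prime_ideal_of R B q"
  using assms unfolding prime_ideal_of_def
  by (auto simp: primeideal.quotient_is_domain primeideal.axioms(1))

text \<open>An ideal \<open>q\<close> maximal among those avoiding \<open>T\<close> is prime: if \<open>a, b \<notin> q\<close>, then both \<open>q + (a)\<close> and
  \<open>q + (b)\<close> meet \<open>T\<close>, and the product of the two elements found there lies in \<open>T\<close> and in
  \<open>q + (a b)\<close>.\<close>

lemma (in cring) primeideal_avoiding:
  assumes I: "ideal I R" and T: "T \<subseteq> carrier R" "\<one> \<in> T" "\<And>s t. s \<in> T \<Longrightarrow> t \<in> T \<Longrightarrow> s \<otimes> t \<in> T"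
    and IT: "I \<inter> T = {}"
  shows "\<exists>q. primeideal q R \<and> I \<subseteq> q \<and> q \<inter> T = {}"
proof -
  let ?S = "{J. ideal J R \<and> I \<subseteq> J \<and> J \<inter> T = {}}"
  have "\<exists>M\<in>?S. \<forall>J\<in>?S. M \<subseteq> J \<longrightarrow> J = M"
  proof (rule subset_Zorn_nonempty)
    show "?S \<noteq> {}" using I IT by auto
    fix C assume C: "C \<noteq> {}" "subset.chain ?S C"
    have "subset.chain {J. ideal J R} C" using C(2) unfolding pred_on.chain_def by auto
    from chain_Union_is_ideal[OF this] have "ideal (\<Union>C) R" using C(1) by simp
    thus "\<Union>C \<in> ?S" using C unfolding pred_on.chain_def by blast
  qed
  then obtain q where q: "ideal q R" "I \<subseteq> q" "q \<inter> T = {}"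
    and qmax: "\<And>J. ideal J R \<Longrightarrow> I \<subseteq> J \<Longrightarrow> J \<inter> T = {} \<Longrightarrow> q \<subseteq> J \<Longrightarrow> J = q"
    by auto
  interpret q: ideal q R by fact
  have enlarge: "\<exists>i\<in>q. \<exists>c\<in>carrier R. i \<oplus> c \<otimes> a \<in> T" if a: "a \<in> carrier R" "a \<notin> q" for a
  proof -
    let ?J = "q <+>\<^bsub>R\<^esub> PIdl a"
    have J: "ideal ?J R" by (rule add_ideals[OF q(1) cgenideal_ideal[OF a(1)]])
    have zero: "\<zero> \<in> PIdl a"
      using additive_subgroup.zero_closed[OF ideal.axioms(1)[OF cgenideal_ideal[OF a(1)]]] .
    have mem: "i \<oplus> c \<in> ?J" if "i \<in> q" "c \<in> PIdl a" for i c
      using that unfolding set_add_def' by blast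
    have qJ: "q \<subseteq> ?J"
    proof
      fix i assume i: "i \<in> q"
      show "i \<in> ?J" using mem[OF i zero] q.Icarr[OF i] by simp
    qed
    have "a \<in> ?J" using mem[OF q.zero_closed cgenideal_self[OF a(1)]] a(1) by simp
    hence "?J \<inter> T \<noteq> {}" using qmax[OF J _ _ qJ] qJ q(2) a(2) by blast
    then obtain t where "t \<in> ?J" "t \<in> T" by blast
    thus ?thesis unfolding set_add_def' cgenideal_def by auto
  qed
  have "primeideal q R"
  proof (rule primeidealI[OF q(1) is_cring])
    show "carrier R \<noteq> q" using q(3) T(2) by auto
    fix a b assume ab: "a \<in> carrier R" "b \<in> carrier R" "a \<otimes> b \<in> q"
    show "a \<in> q \<or> b \<in> q"
    proof (rule ccontr)
      assume n: "\<not> ?thesis"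
      obtain i c where i: "i \<in> q" "c \<in> carrier R" "i \<oplus> c \<otimes> a \<in> T" using enlarge ab n by blast
      obtain j d where j: "j \<in> q" "d \<in> carrier R" "j \<oplus> d \<otimes> b \<in> T" using enlarge ab n by blast
      have cr: "i \<in> carrier R" "j \<in> carrier R" using i j q.Icarr by auto
      have "(i \<oplus> c \<otimes> a) \<otimes> (j \<oplus> d \<otimes> b) = i \<otimes> (j \<oplus> d \<otimes> b) \<oplus> (c \<otimes> a) \<otimes> j \<oplus> (c \<otimes> d) \<otimes> (a \<otimes> b)"
        using cr i j ab by algebra
      moreover have "\<dots> \<in> q"
        using q.I_r_closed[OF i(1), of "j \<oplus> d \<otimes> b"] q.I_l_closed[OF j(1), of "c \<otimes> a"]
          q.I_l_closed[OF ab(3), of "c \<otimes> d"] cr i j ab by (simp add: q.a_closed)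
      ultimately show False using T(3)[OF i(3) j(3)] q(3) by auto
    qed
  qed
  thus ?thesis using q by auto
qed

section \<open>Values of polynomials of bounded degree\<close>

text \<open>The values at \<open>x\<close> of the polynomials of degree less than \<open>n\<close> with coefficients in \<open>M\<close>. The
  recursion splits off the leading term, because the later arguments eliminate or combine leading
  terms.
  For a subring \<open>A\<close> the union over all \<open>n\<close> is \<open>A[x]\<close>, and for an ideal \<open>p\<close> of \<open>A\<close> it is
  \<open>p A[x]\<close>.\<close>

primrec poly_values :: "('a, 'b) ring_scheme \<Rightarrow> 'a set \<Rightarrow> 'a \<Rightarrow> nat \<Rightarrow> 'a set" where
  "poly_values R M x 0 = {\<zero>\<^bsub>R\<^esub>}"
| "poly_values R M x (Suc n) =
     {a \<otimes>\<^bsub>R\<^esub> x [^]\<^bsub>R\<^esub> n \<oplus>\<^bsub>R\<^esub> r | a r. a \<in> M \<and> r \<in> poly_values R M x n}"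

lemma poly_values_mono_coeffs:
  assumes "M \<subseteq> N"
  shows "poly_values R M x n \<subseteq> poly_values R N x n"
  using assms by (induction n) auto

context cring
begin

lemma poly_values_carrier:
  assumes "M \<subseteq> carrier R" "x \<in> carrier R"
  shows "poly_values R M x n \<subseteq> carrier R"
  using assms by (induction n) auto

lemma poly_values_zero:
  assumes "\<zero> \<in> M" "x \<in> carrier R"
  shows "\<zero> \<in> poly_values R M x n"
proof (induction n)
  case (Suc n)
  have "\<zero> = \<zero> \<otimes> x [^] n \<oplus> \<zero>" using assms by simp
  thus ?case using Suc assms(1) by (simp only: poly_values.simps mem_Collect_eq) blast
qed simp

lemma poly_values_add:
  assumes M: "M \<subseteq> carrier R" "\<And>a b. a \<in> M \<Longrightarrow> b \<in> M \<Longrightarrow> a \<oplus> b \<in> M" and x: "x \<in> carrier R"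
  shows "u \<in> poly_values R M x n \<Longrightarrow> v \<in> poly_values R M x n \<Longrightarrow> u \<oplus> v \<in> poly_values R M x n"
proof (induction n arbitrary: u v)
  case (Suc n)
  then obtain a r b s where ab: "a \<in> M" "b \<in> M" "r \<in> poly_values R M x n" "s \<in> poly_values R M x n"
    "u = a \<otimes> x [^] n \<oplus> r" "v = b \<otimes> x [^] n \<oplus> s" by auto
  have c: "a \<in> carrier R" "b \<in> carrier R" "r \<in> carrier R" "s \<in> carrier R" "x [^] n \<in> carrier R"
    using ab M x subsetD[OF poly_values_carrier[OF M(1) x]] by auto
  have "u \<oplus> v = (a \<oplus> b) \<otimes> x [^] n \<oplus> (r \<oplus> s)" unfolding ab using c by algebra
  thus ?case using Suc.IH[OF ab(3,4)] M(2)[OF ab(1,2)] by (simp, blast)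
qed simp

text \<open>Two coefficient sets occur because scaling by an element of \<open>p\<close> moves coefficients from \<open>A\<close>
  to \<open>p\<close>.\<close>

lemma poly_values_scale:
  assumes M: "M \<subseteq> carrier R" and c: "c \<in> carrier R" "\<And>a. a \<in> M \<Longrightarrow> c \<otimes> a \<in> N" and x: "x \<in> carrier R"
  shows "u \<in> poly_values R M x n \<Longrightarrow> c \<otimes> u \<in> poly_values R N x n"
proof (induction n arbitrary: u)
  case (Suc n)
  then obtain a r where ab: "a \<in> M" "r \<in> poly_values R M x n" "u = a \<otimes> x [^] n \<oplus> r" by auto
  have cc: "a \<in> carrier R" "r \<in> carrier R" "x [^] n \<in> carrier R"
    using ab M x subsetD[OF poly_values_carrier[OF M x]] by auto
  have "c \<otimes> u = (c \<otimes> a) \<otimes> x [^] n \<oplus> c \<otimes> r" unfolding ab using c cc by algebra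
  thus ?case using Suc.IH ab c by auto
qed (use c in simp)

lemma poly_values_mono_Suc:
  assumes M: "M \<subseteq> carrier R" "\<zero> \<in> M" and x: "x \<in> carrier R"
  shows "poly_values R M x n \<subseteq> poly_values R M x (Suc n)"
proof
  fix u assume u: "u \<in> poly_values R M x n"
  hence "u = \<zero> \<otimes> x [^] n \<oplus> u" using poly_values_carrier[OF M(1) x, of n] x by auto
  thus "u \<in> poly_values R M x (Suc n)" using u M by auto
qed

lemma poly_values_mono:
  assumes "M \<subseteq> carrier R" "\<zero> \<in> M" "x \<in> carrier R" "m \<le> n"
  shows "poly_values R M x m \<subseteq> poly_values R M x n"
  using lift_Suc_mono_le[of "poly_values R M x", OF _ assms(4)] poly_values_mono_Suc[OF assms(1-3)]
  by blast

lemma poly_values_monom: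
  assumes "M \<subseteq> carrier R" "\<zero> \<in> M" "x \<in> carrier R" "a \<in> M" "i < n"
  shows "a \<otimes> x [^] i \<in> poly_values R M x n"
proof -
  have "a \<otimes> x [^] i = a \<otimes> x [^] i \<oplus> \<zero>" using assms by auto
  hence "a \<otimes> x [^] i \<in> poly_values R M x (Suc i)"
    using assms poly_values_zero[of M x i] by auto
  thus ?thesis using poly_values_mono[OF assms(1-3), of "Suc i" n] assms(5) by auto
qed

lemma poly_values_const:
  assumes "M \<subseteq> carrier R" "\<zero> \<in> M" "x \<in> carrier R" "a \<in> M"
  shows "a \<in> poly_values R M x (Suc n)"
proof -
  have "a \<otimes> x [^] (0::nat) \<in> poly_values R M x (Suc n)" by (rule poly_values_monom[OF assms]) simp
  moreover have "a \<otimes> x [^] (0::nat) = a" using assms by auto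
  ultimately show ?thesis by simp
qed

lemma poly_values_times_x:
  assumes M: "M \<subseteq> carrier R" "\<zero> \<in> M" and x: "x \<in> carrier R"
  shows "u \<in> poly_values R M x n \<Longrightarrow> x \<otimes> u \<in> poly_values R M x (Suc n)"
proof (induction n arbitrary: u)
  case 0
  thus ?case using poly_values_zero[OF M(2) x, of 1] x by auto
next
  case (Suc n)
  then obtain a r where ab: "a \<in> M" "r \<in> poly_values R M x n" "u = a \<otimes> x [^] n \<oplus> r" by auto
  have cc: "a \<in> carrier R" "r \<in> carrier R" "x [^] n \<in> carrier R"
    using ab M x subsetD[OF poly_values_carrier[OF M(1) x]] by auto
  have "x \<otimes> u = a \<otimes> (x [^] n \<otimes> x) \<oplus> x \<otimes> r" unfolding ab using x cc by algebra
  hence "x \<otimes> u = a \<otimes> x [^] Suc n \<oplus> x \<otimes> r" by simp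
  thus ?case using Suc.IH[OF ab(2)] ab by (auto simp del: nat_pow_Suc)
qed

lemma poly_values_times_pow:
  assumes M: "M \<subseteq> carrier R" "\<zero> \<in> M" and x: "x \<in> carrier R" and u: "u \<in> poly_values R M x n"
  shows "x [^] k \<otimes> u \<in> poly_values R M x (k + n)"
proof (induction k)
  case 0
  thus ?case using u poly_values_carrier[OF M(1) x, of n] by auto
next
  case (Suc k)
  have "u \<in> carrier R" using u poly_values_carrier[OF M(1) x, of n] by auto
  hence "x [^] Suc k \<otimes> u = x \<otimes> (x [^] k \<otimes> u)" using x by (simp add: m_ac)
  thus ?case using poly_values_times_x[OF M x Suc] by simp
qed

lemma poly_values_mult:
  assumes A: "A \<subseteq> carrier R" and M: "additive_subgroup M R" "\<And>a b. a \<in> A \<Longrightarrow> b \<in> M \<Longrightarrow> a \<otimes> b \<in> M"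
    and x: "x \<in> carrier R" and v: "v \<in> poly_values R M x n"
  shows "u \<in> poly_values R A x m \<Longrightarrow> u \<otimes> v \<in> poly_values R M x (m + n)"
proof (induction m arbitrary: u)
  interpret M: additive_subgroup M R by fact
  note M' = M.a_subset M.zero_closed
  have vc: "v \<in> carrier R" using v poly_values_carrier[OF M'(1) x, of n] by auto
  {
    case 0
    thus ?case using vc poly_values_zero[OF M'(2) x] by auto
  next
    case (Suc m)
    then obtain a r where ab: "a \<in> A" "r \<in> poly_values R A x m" "u = a \<otimes> x [^] m \<oplus> r" by auto
    have cc: "a \<in> carrier R" "r \<in> carrier R" "x [^] m \<in> carrier R"
      using ab A x subsetD[OF poly_values_carrier[OF A x]] by auto
    have "a \<otimes> v \<in> poly_values R M x n"
      by (rule poly_values_scale[OF M'(1) cc(1) M(2)[OF ab(1)] x v])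
    hence "x [^] m \<otimes> (a \<otimes> v) \<in> poly_values R M x (m + n)"
      by (rule poly_values_times_pow[OF M' x])
    from poly_values_add[OF M'(1) M.a_closed x this Suc.IH[OF ab(2)]]
    have "x [^] m \<otimes> (a \<otimes> v) \<oplus> r \<otimes> v \<in> poly_values R M x (m + n)" .
    moreover have "u \<otimes> v = x [^] m \<otimes> (a \<otimes> v) \<oplus> r \<otimes> v" unfolding ab using cc vc by algebra
    ultimately show ?case using poly_values_mono[OF M' x, of "m + n" "Suc m + n"] by auto
  }
qed

end

section \<open>Maximal pairs of a commutative ring\<close>

locale prime_pair = cring +
  fixes A p
  assumes sub: "subring A R"
    and prime: "prime_ideal_of R A p"
begin

lemmas A_carrier = subringE(1)[OF sub]
lemmas A_closed = subringE(2,3,5-7)[OF sub]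

lemmas p_closed = prime_ideal_ofD[OF sub prime]

lemma p_carrier: "p \<subseteq> carrier R"
  using p_closed(1) A_carrier by blast

lemma additive_subgroups: "additive_subgroup A R" "additive_subgroup p R"
proof -
  have "subgroup A (add_monoid R)"
    by (rule add.subgroupI) (use A_carrier A_closed in \<open>auto simp flip: a_inv_def\<close>)
  thus "additive_subgroup A R" by (rule additive_subgroup.intro)
  have "subgroup p (add_monoid R)"
    by (rule add.subgroupI) (use p_carrier p_closed in \<open>auto simp flip: a_inv_def\<close>)
  thus "additive_subgroup p R" by (rule additive_subgroup.intro)
qed

text \<open>Nakayama's lemma for the module generated by \<open>\<one>, z, \<dots>, z^k\<close> over the localization of \<open>A\<close> at
  \<open>p\<close>, with denominators cleared: elements of \<open>A - p\<close> act like units. The proof eliminates the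
  highest power. From \<open>s z^(k+1) = b z^(k+1) + r\<close> with \<open>b \<in> p\<close> one gets \<open>t z^(k+1) = r\<close> for
  \<open>t = s - b \<in> A - p\<close>, and multiplying the other relations by \<open>t\<close> removes \<open>z^(k+1)\<close> from them. The
  factor \<open>s t\<close> again lies in \<open>A - p\<close>; with only \<open>\<one>\<close> left, \<open>s\<close> itself would be in \<open>p\<close>.\<close>

lemma nakayama_powers:
  assumes z: "z \<in> carrier R"
  shows "s \<in> A - p \<Longrightarrow> \<exists>j\<le>k. s \<otimes> z [^] j \<notin> poly_values R p z (Suc k)"
proof (rule ccontr, induction k arbitrary: s)
  case 0
  hence "s \<otimes> z [^] (0::nat) \<in> poly_values R p z (Suc 0)" by blast
  then obtain a where "a \<in> p" "s \<otimes> z [^] (0::nat) = a \<otimes> z [^] (0::nat) \<oplus> \<zero>" by auto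
  moreover have "a \<in> carrier R" "s \<in> carrier R" using \<open>a \<in> p\<close> p_carrier 0(1) A_carrier by auto
  ultimately have "s = a" by simp
  thus ?case using 0(1) \<open>a \<in> p\<close> by auto
next
  case (Suc k)
  note pv = p_carrier p_closed(2) z
  have s: "s \<in> A" "s \<notin> p" "s \<in> carrier R" using Suc.prems A_carrier by auto
  have "s \<otimes> z [^] Suc k \<in> poly_values R p z (Suc (Suc k))" using Suc.prems(2) by blast
  then obtain b r where br: "b \<in> p" "r \<in> poly_values R p z (Suc k)"
    "s \<otimes> z [^] Suc k = b \<otimes> z [^] Suc k \<oplus> r"
    unfolding poly_values.simps(2)[of _ _ _ "Suc k"] by blast
  define t where "t = s \<ominus> b"
  have b: "b \<in> A" "b \<in> carrier R" using br p_closed(1) p_carrier by auto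
  have zk: "z [^] i \<in> carrier R" for i :: nat using z by simp
  have rc: "r \<in> carrier R" using br(2) poly_values_carrier[OF pv(1,3)] by blast
  have t: "t \<in> A" "t \<in> carrier R" unfolding t_def a_minus_def using A_closed s b by auto
  have "t \<oplus> b = s" unfolding t_def using s b by algebra
  hence tp: "t \<notin> p" using p_closed(4)[OF _ br(1)] s by auto
  have "t \<otimes> z [^] Suc k = s \<otimes> z [^] Suc k \<ominus> b \<otimes> z [^] Suc k"
    unfolding t_def using s(3) b(2) zk[of "Suc k"] by algebra
  hence tz: "t \<otimes> z [^] Suc k = r" unfolding br(3) using rc b(2) zk[of "Suc k"] by algebra
  show ?case
  proof (rule Suc.IH)
    show "s \<otimes> t \<in> A - p" using s t tp A_closed(4) p_closed(7) by auto
    have "\<forall>j\<le>k. (s \<otimes> t) \<otimes> z [^] j \<in> poly_values R p z (Suc k)"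
    proof (intro allI impI)
      fix j assume "j \<le> k"
      hence "s \<otimes> z [^] j \<in> poly_values R p z (Suc (Suc k))"
        using Suc.prems(2) by (auto simp del: poly_values.simps)
      then obtain c r' where cr: "c \<in> p" "r' \<in> poly_values R p z (Suc k)"
        "s \<otimes> z [^] j = c \<otimes> z [^] Suc k \<oplus> r'"
        unfolding poly_values.simps(2)[of _ _ _ "Suc k"] by blast
      have cc: "c \<in> carrier R" "r' \<in> carrier R"
        using cr poly_values_carrier[OF pv(1,3)] p_carrier by blast+
      have "(s \<otimes> t) \<otimes> z [^] j = t \<otimes> (s \<otimes> z [^] j)" using s t zk[of j] by algebra
      also have "\<dots> = c \<otimes> (t \<otimes> z [^] Suc k) \<oplus> t \<otimes> r'"
        unfolding cr(3) using cc t zk[of "Suc k"] by algebra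
      also have "\<dots> = c \<otimes> r \<oplus> t \<otimes> r'" unfolding tz ..
      also have "\<dots> \<in> poly_values R p z (Suc k)"
      proof (rule poly_values_add[OF p_carrier p_closed(4) z])
        show "c \<otimes> r \<in> poly_values R p z (Suc k)"
          by (rule poly_values_scale[OF p_carrier cc(1) _ z br(2)]) (use cr(1) p_closed(1,5) in blast)
        show "t \<otimes> r' \<in> poly_values R p z (Suc k)"
          by (rule poly_values_scale[OF p_carrier t(2) _ z cr(2)]) (use t(1) p_closed(5) in blast)
      qed
      finally show "(s \<otimes> t) \<otimes> z [^] j \<in> poly_values R p z (Suc k)" .
    qed
    thus "\<not> (\<exists>j\<le>k. (s \<otimes> t) \<otimes> z [^] j \<notin> poly_values R p z (Suc k))" by blast
  qed
qed

text \<open>Multiplication by \<open>a^l\<close> turns each \<open>c x^i\<close> with \<open>i \<le> l\<close> into \<open>(c a^(l-i)) (a x)^i\<close>; this makes an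
  equation for \<open>x\<close> with leading coefficient \<open>a\<close> into a monic one for \<open>a x\<close>.\<close>

lemma poly_values_homogenize:
  assumes x: "x \<in> carrier R" and a: "a \<in> A"
  shows "r \<in> poly_values R A x m \<Longrightarrow> m \<le> Suc l \<Longrightarrow> a [^] l \<otimes> r \<in> poly_values R A (a \<otimes> x) m"
proof (induction m arbitrary: r)
  case 0
  thus ?case using a A_carrier by auto
next
  case (Suc m)
  have ac: "a \<in> carrier R" using a A_carrier by auto
  have apow: "a [^] i \<in> A" for i :: nat by (induction i) (use a A_closed in auto)
  obtain c r' where cr: "c \<in> A" "r' \<in> poly_values R A x m" "r = c \<otimes> x [^] m \<oplus> r'"
    using Suc.prems by auto
  have cc: "c \<in> carrier R" "r' \<in> carrier R" "x [^] m \<in> carrier R" "a [^] m \<in> carrier R"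
    "a [^] (l - m) \<in> carrier R"
    using cr A_carrier poly_values_carrier[OF A_carrier x] x ac by auto
  have l: "a [^] l = a [^] (l - m) \<otimes> a [^] m" using Suc.prems(2) ac by (simp add: nat_pow_mult)
  have "a [^] l \<otimes> r = a [^] l \<otimes> (c \<otimes> x [^] m) \<oplus> a [^] l \<otimes> r'"
    unfolding cr(3) using cc ac by (simp add: r_distr)
  also have "a [^] l \<otimes> (c \<otimes> x [^] m) = (a [^] (l - m) \<otimes> c) \<otimes> (a [^] m \<otimes> x [^] m)"
    unfolding l using cc by algebra
  also have "a [^] m \<otimes> x [^] m = (a \<otimes> x) [^] m" using ac x by (simp add: nat_pow_distrib)
  finally have "a [^] l \<otimes> r = (a [^] (l - m) \<otimes> c) \<otimes> (a \<otimes> x) [^] m \<oplus> a [^] l \<otimes> r'" .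
  moreover have "a [^] (l - m) \<otimes> c \<in> A" using apow cr(1) A_closed(4) by auto
  ultimately show ?case using Suc.IH[OF cr(2)] Suc.prems(2) by auto
qed

end

text \<open>Maximality is required for the rings alone: \<open>B = A\<close> and \<open>p = A \<inter> q\<close> already force \<open>q = p\<close>,
  as \<open>q \<subseteq> B\<close>.\<close>

locale maximal_prime_pair = prime_pair +
  assumes maximal: "\<lbrakk>subring B R; prime_ideal_of R B q; A \<subseteq> B; p = A \<inter> q\<rbrakk> \<Longrightarrow> B = A"
begin

text \<open>A prime ideal of \<open>A[x]\<close> that contains \<open>p A[x]\<close> and avoids \<open>A - p\<close> contracts to \<open>p\<close>, so by
  maximality it can only exist if \<open>x \<in> A\<close>. By \<open>primeideal_avoiding\<close> it does exist as soon as
  \<open>p A[x]\<close> avoids \<open>A - p\<close>.\<close>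

lemma extended_ideal_meets_complement:
  assumes x: "x \<in> carrier R" "x \<notin> A"
  shows "\<exists>n. \<exists>s\<in>A - p. s \<in> poly_values R p x n"
proof (rule ccontr)
  assume none: "\<not> ?thesis"
  define B where "B = (\<Union>n. poly_values R A x n)"
  define I where "I = (\<Union>n. poly_values R p x n)"
  note pA = A_carrier A_closed(1) x(1) and pp = p_carrier p_closed(2) x(1)
  have add_Union: "u \<oplus> v \<in> (\<Union>n. poly_values R M x n)"
    if "u \<in> (\<Union>n. poly_values R M x n)" "v \<in> (\<Union>n. poly_values R M x n)" and M: "additive_subgroup M R"
    for u v M
  proof -
    interpret M: additive_subgroup M R by fact
    from that obtain m n where "u \<in> poly_values R M x m" "v \<in> poly_values R M x n" by auto
    hence "u \<in> poly_values R M x (m + n)" "v \<in> poly_values R M x (m + n)"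
      using poly_values_mono[OF M.a_subset M.zero_closed x(1), of m "m + n"]
        poly_values_mono[OF M.a_subset M.zero_closed x(1), of n "m + n"] by auto
    from poly_values_add[OF M.a_subset M.a_closed x(1) this] show ?thesis by blast
  qed
  have mult_Union: "u \<otimes> v \<in> (\<Union>n. poly_values R M x n)"
    if u: "u \<in> B" and v: "v \<in> (\<Union>n. poly_values R M x n)"
      and M: "additive_subgroup M R" "\<And>a b. a \<in> A \<Longrightarrow> b \<in> M \<Longrightarrow> a \<otimes> b \<in> M" for u v M
  proof -
    from u v obtain m n where "u \<in> poly_values R A x m" "v \<in> poly_values R M x n"
      unfolding B_def by auto
    from poly_values_mult[OF A_carrier M x(1) this(2,1)] show ?thesis by blast
  qed
  have AB: "A \<subseteq> B"
    unfolding B_def using poly_values_const[OF pA, of _ 0] by blast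
  have pI: "p \<subseteq> I"
    unfolding I_def using poly_values_const[OF pp, of _ 0] by blast
  have Bc: "B \<subseteq> carrier R" unfolding B_def using poly_values_carrier[OF A_carrier x(1)] by blast
  have Bm: "u \<otimes> v \<in> B" if "u \<in> B" "v \<in> B" for u v
    using mult_Union[OF that(1) that(2)[unfolded B_def] additive_subgroups(1) A_closed(4)]
    by (simp add: B_def)
  have B: "subring B R"
  proof (rule subringI[OF Bc])
    show one: "\<one> \<in> B" using AB A_closed(2) by auto
    show "u \<otimes> v \<in> B" if "u \<in> B" "v \<in> B" for u v by (rule Bm[OF that])
    show "u \<oplus> v \<in> B" if "u \<in> B" "v \<in> B" for u v
      using add_Union[OF _ _ additive_subgroups(1)] that unfolding B_def by blast
    fix u assume u: "u \<in> B"
    have "\<ominus> \<one> \<otimes> u \<in> B" using Bm[OF _ u] AB A_closed(2,3) by blast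
    thus "\<ominus> u \<in> B" using u Bc by (auto simp: l_minus)
  qed
  have Il: "u \<otimes> v \<in> I" if "u \<in> B" "v \<in> I" for u v
    using mult_Union[OF that(1) _ additive_subgroups(2) p_closed(5)] that(2) unfolding I_def by blast
  have IB: "I \<subseteq> B"
  proof
    fix v assume "v \<in> I"
    then obtain n where v: "v \<in> poly_values R p x n" unfolding I_def by auto
    thus "v \<in> B" unfolding B_def using poly_values_mono_coeffs[OF p_closed(1)] by blast
  qed
  have I: "ideal I (R\<lparr>carrier := B\<rparr>)"
    unfolding ideal_of_subring_iff[OF B]
  proof (intro conjI ballI)
    show "I \<subseteq> B" by (rule IB)
    show "\<zero> \<in> I" using pI p_closed(2) by auto
    show "u \<oplus> v \<in> I" if "u \<in> I" "v \<in> I" for u v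
      using add_Union[OF _ _ additive_subgroups(2)] that unfolding I_def by blast
    fix a v assume av: "a \<in> B" "v \<in> I"
    show "a \<otimes> v \<in> I" by (rule Il[OF av])
    moreover have "v \<otimes> a = a \<otimes> v" by (rule m_comm) (use av IB Bc in auto)
    ultimately show "v \<otimes> a \<in> I" by simp
  qed
  have cB: "cring (R\<lparr>carrier := B\<rparr>)"
    using subcring_iff[OF Bc] subcringI'[OF B] by simp
  have "\<exists>q. primeideal q (R\<lparr>carrier := B\<rparr>) \<and> I \<subseteq> q \<and> q \<inter> (A - p) = {}"
  proof (rule cring.primeideal_avoiding[OF cB I])
    show "A - p \<subseteq> carrier (R\<lparr>carrier := B\<rparr>)" using AB by auto
    show "\<one>\<^bsub>R\<lparr>carrier := B\<rparr>\<^esub> \<in> A - p" using A_closed(2) p_closed(3) by simp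
    show "s \<otimes>\<^bsub>R\<lparr>carrier := B\<rparr>\<^esub> t \<in> A - p" if "s \<in> A - p" "t \<in> A - p" for s t
      using that A_closed(4) p_closed(7) by auto
    show "I \<inter> (A - p) = {}" using none unfolding I_def by blast
  qed
  then obtain q where q: "primeideal q (R\<lparr>carrier := B\<rparr>)" "I \<subseteq> q" "q \<inter> (A - p) = {}" by blast
  have "B = A"
    by (rule maximal[OF B primeideal_imp_prime_ideal_of[OF q(1)] AB])
      (use q pI p_closed(1) in blast)
  moreover have "\<one> \<otimes> x [^] (1::nat) \<in> poly_values R A x 2"
    by (rule poly_values_monom[OF pA A_closed(2)]) simp
  hence "x \<in> B" unfolding B_def using x(1) by auto
  ultimately show False using x(2) by simp
qed

text \<open>If \<open>z\<close> is integral over \<open>A\<close> of degree \<open>n\<close>, every element of \<open>p A[z]\<close> is already a polynomial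
  value of degree less than \<open>n\<close>, since higher powers can be rewritten without changing where the
  coefficients lie. If \<open>z \<notin> A\<close>, some \<open>s \<in> A - p\<close> lies in \<open>p A[z]\<close>; multiplication by \<open>s\<close> then carries
  all powers of \<open>z\<close> into this set, which contradicts \<open>nakayama_powers\<close>.\<close>

lemma integrally_closed:
  assumes z: "z \<in> carrier R" and int: "z [^] n \<in> poly_values R A z n"
  shows "z \<in> A"
proof (rule ccontr)
  assume "z \<notin> A"
  then obtain m s where s: "s \<in> A - p" "s \<in> poly_values R p z m"
    using extended_ideal_meets_complement[OF z] by blast
  note pA = A_carrier A_closed(1) z and pp = p_carrier p_closed(2) z
  obtain k where n: "n = Suc k"
  proof (cases n)
    case 0
    hence "\<one> = \<zero>" using int by simp
    thus ?thesis using p_closed(2,3) by simp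
  qed
  have times_top: "a \<otimes> z [^] n \<in> poly_values R M z n" if "a \<in> M" "M = A \<or> M = p" for a M
    by (rule poly_values_scale[OF A_carrier _ _ z int])
      (use that A_carrier p_carrier A_closed(4) p_closed(6) in auto)
  have stable: "z \<otimes> u \<in> poly_values R M z n"
    if u: "u \<in> poly_values R M z n" and M: "M = A \<or> M = p" for u M
  proof -
    have M': "M \<subseteq> carrier R" "\<zero> \<in> M" "\<And>a b. a \<in> M \<Longrightarrow> b \<in> M \<Longrightarrow> a \<oplus> b \<in> M"
      using M A_carrier p_carrier A_closed p_closed(2,4) by auto
    obtain a r where ar: "a \<in> M" "r \<in> poly_values R M z k" "u = a \<otimes> z [^] k \<oplus> r"
      using u n by auto
    have c: "a \<in> carrier R" "r \<in> carrier R" "z [^] k \<in> carrier R"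
      using ar poly_values_carrier[OF M'(1) z] M'(1) z by auto
    have "z \<otimes> u = a \<otimes> (z [^] k \<otimes> z) \<oplus> z \<otimes> r" unfolding ar using c z by algebra
    hence "z \<otimes> u = a \<otimes> z [^] n \<oplus> z \<otimes> r" unfolding n by simp
    moreover have "z \<otimes> r \<in> poly_values R M z n"
      unfolding n by (rule poly_values_times_x[OF M'(1,2) z ar(2)])
    ultimately show ?thesis
      using poly_values_add[OF M'(1,3) z times_top[OF ar(1) M]] by simp
  qed
  have stable_pow: "z [^] j \<otimes> u \<in> poly_values R M z n"
    if u: "u \<in> poly_values R M z n" and M: "M = A \<or> M = p" for u M and j :: nat
  proof (induction j)
    have uc: "u \<in> carrier R"
      using u M poly_values_carrier[OF p_carrier z] poly_values_carrier[OF A_carrier z] by blast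
    {
      case 0
      show ?case using u uc by simp
    next
      case (Suc j)
      have "z [^] Suc j \<otimes> u = z \<otimes> (z [^] j \<otimes> u)" using uc z by (simp add: m_ac)
      thus ?case using stable[OF Suc M] by simp
    }
  qed
  have pow: "z [^] j \<in> poly_values R A z n" for j :: nat
    using stable_pow[OF poly_values_const[OF pA A_closed(2), of k, folded n], of j] z by simp
  have "poly_values R p z m \<subseteq> poly_values R p z n"
  proof (induction m)
    case 0
    show ?case using poly_values_zero[OF pp(2,3)] by simp
  next
    case (Suc m)
    have "a \<otimes> z [^] m \<in> poly_values R p z n" if "a \<in> p" for a
      by (rule poly_values_scale[OF A_carrier _ _ z pow])
        (use that p_carrier p_closed(6) in auto)
    thus ?case using Suc poly_values_add[OF p_carrier p_closed(4) z] by auto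
  qed
  hence sn: "s \<in> poly_values R p z n" using s(2) by auto
  have "\<forall>j\<le>k. s \<otimes> z [^] j \<in> poly_values R p z (Suc k)"
  proof (intro allI impI)
    fix j :: nat
    have "s \<otimes> z [^] j = z [^] j \<otimes> s" using s(1) A_carrier z by (intro m_comm) auto
    thus "s \<otimes> z [^] j \<in> poly_values R p z (Suc k)" using stable_pow[OF sn, of j] n by simp
  qed
  thus False using nakayama_powers[OF z s(1), of k] by blast
qed

text \<open>The leading coefficient \<open>a\<close> of a relation of least degree is the multiplier: integral dependence
  puts \<open>a x\<close> into \<open>A\<close>, and minimality keeps it out of \<open>p\<close>.\<close>

lemma valuation_property:
  assumes x: "x \<in> carrier R" "x \<notin> A"
  shows "\<exists>a\<in>p. x \<otimes> a \<in> A - p"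
proof -
  let ?P = "\<lambda>n. \<exists>s\<in>A - p. s \<in> poly_values R p x n"
  define n where "n = (LEAST n. ?P n)"
  have "?P n" unfolding n_def using extended_ideal_meets_complement[OF x] by (rule LeastI_ex)
  then obtain s where s: "s \<in> A" "s \<notin> p" "s \<in> poly_values R p x n" by blast
  have least: "\<not> ?P m" if "m < n" for m using not_less_Least that unfolding n_def by blast
  have sc: "s \<in> carrier R" using s A_carrier by auto
  obtain m where m: "n = Suc m" using s p_closed(2) by (cases n) auto
  obtain a r where ar: "a \<in> p" "r \<in> poly_values R p x m" "s = a \<otimes> x [^] m \<oplus> r"
    using s(3) m by auto
  have a: "a \<in> A" "a \<in> carrier R" using ar p_closed(1) p_carrier by auto
  have "m \<noteq> 0"
  proof
    assume "m = 0"
    hence "s = a" using ar a by simp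
    thus False using s ar by simp
  qed
  then obtain l where l: "m = Suc l" by (cases m) auto
  have rc: "r \<in> carrier R" using ar(2) poly_values_carrier[OF p_carrier x(1)] by blast
  let ?z = "a \<otimes> x"
  have z: "?z \<in> carrier R" using a x by simp
  have al: "a [^] l \<in> A" "a [^] l \<in> carrier R"
    using a by (induction l) (auto simp: A_closed)
  have "r \<in> poly_values R A x m" using ar(2) poly_values_mono_coeffs[OF p_closed(1)] by blast
  hence arl: "a [^] l \<otimes> r \<in> poly_values R A ?z m"
    by (rule poly_values_homogenize[OF x(1) a(1)]) (simp add: l)
  \<comment> \<open>The relation for \<open>s\<close> times \<open>a^l\<close>, solved for its leading term
    \<open>a^l a x^m = (a x)^m\<close>, as \<open>m = l + 1\<close>.\<close>
  have "?z [^] m = a [^] l \<otimes> s \<oplus> \<ominus> \<one> \<otimes> (a [^] l \<otimes> r)"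
  proof -
    have xm: "x [^] m \<in> carrier R" using x by simp
    have "a [^] l \<otimes> s \<oplus> \<ominus> \<one> \<otimes> (a [^] l \<otimes> r) = (a [^] l \<otimes> a) \<otimes> x [^] m"
      unfolding ar(3) using al(2) a(2) xm rc by algebra
    also have "\<dots> = ?z [^] m" using a x l by (simp add: nat_pow_distrib m_ac)
    finally show ?thesis ..
  qed
  moreover have "a [^] l \<otimes> s \<in> poly_values R A ?z m"
    unfolding l by (rule poly_values_const[OF A_carrier A_closed(1) z A_closed(4)[OF al(1) s(1)]])
  moreover have "\<ominus> \<one> \<otimes> (a [^] l \<otimes> r) \<in> poly_values R A ?z m"
    by (rule poly_values_scale[OF A_carrier _ _ z arl]) (use A_closed in auto)
  ultimately have "?z [^] m \<in> poly_values R A ?z m"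
    using poly_values_add[OF A_carrier A_closed(5) z] by simp
  hence zA: "?z \<in> A" by (rule integrally_closed[OF z])
  have "?z \<notin> p"
  proof
    \<comment> \<open>Then \<open>a x^m = z x^l\<close> is a term of lower degree with coefficient in \<open>p\<close>.\<close>
    assume zp: "?z \<in> p"
    obtain b r' where br: "b \<in> p" "r' \<in> poly_values R p x l" "r = b \<otimes> x [^] l \<oplus> r'"
      using ar(2) l by auto
    have c: "b \<in> carrier R" "r' \<in> carrier R" "x [^] l \<in> carrier R"
      using br p_carrier poly_values_carrier[OF p_carrier x(1)] x by auto
    have "s = a \<otimes> (x [^] l \<otimes> x) \<oplus> (b \<otimes> x [^] l \<oplus> r')" unfolding ar(3) br(3) l by simp
    hence "s = (?z \<oplus> b) \<otimes> x [^] l \<oplus> r'" using c a x by algebra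
    hence "s \<in> poly_values R p x m" unfolding l using p_closed(4)[OF zp br(1)] br(2) by auto
    thus False using least[of m] m s by auto
  qed
  moreover have "x \<otimes> a = ?z" using a x by (simp add: m_comm)
  ultimately show ?thesis using zA by (intro bexI[OF _ ar(1)]) simp
qed

end


section \<open>Pairs of a superring and their even parts\<close>

context superring
begin

lemma E_carrier: "E \<subseteq> carrier R" and D_carrier: "D \<subseteq> carrier R"
  using additive_subgroup.a_subset even_additive_subgroup odd_additive_subgroup by blast+

lemmas E_additive = additive_subgroup.zero_closed[OF even_additive_subgroup]
  additive_subgroup.a_closed[OF even_additive_subgroup]
  additive_subgroup.a_inv_closed[OF even_additive_subgroup]

lemmas D_additive = additive_subgroup.zero_closed[OF odd_additive_subgroup]
  additive_subgroup.a_closed[OF odd_additive_subgroup]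
  additive_subgroup.a_inv_closed[OF odd_additive_subgroup]

lemma E_D_decomposition:
  assumes "x \<in> carrier R"
  obtains e d where "e \<in> E" "d \<in> D" "x = e \<oplus> d"
  using assms unfolding grading_sum[symmetric] set_add_def' by blast

lemma even_component_unique:
  assumes "e \<in> E" "d \<in> D" "e' \<in> E" "d' \<in> D" "e \<oplus> d = e' \<oplus> d'"
  shows "e = e'"
proof -
  have c: "e \<in> carrier R" "d \<in> carrier R" "e' \<in> carrier R" "d' \<in> carrier R"
    using assms E_carrier D_carrier by auto
  have "e \<ominus> e' = (e \<oplus> d) \<ominus> d \<ominus> e'" using c by algebra
  also have "\<dots> = d' \<ominus> d" unfolding assms(5) using c by algebra
  finally have "e \<ominus> e' \<in> D" using assms D_additive by (simp add: a_minus_def)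
  moreover have "e \<ominus> e' \<in> E" using assms E_additive by (simp add: a_minus_def)
  ultimately have "e \<ominus> e' = \<zero>" using grading_direct by blast
  thus ?thesis using c by simp
qed

text \<open>Write \<open>\<one> = e + d\<close>. The even part of \<open>e = \<one> e\<close> gives \<open>e = e e\<close>, so \<open>d e = \<zero>\<close>, and then
  \<open>d = \<one> d = e d + d d = \<zero>\<close>.\<close>

lemma one_even: "\<one> \<in> E"
proof -
  obtain e d where ed: "e \<in> E" "d \<in> D" "\<one> = e \<oplus> d" using E_D_decomposition[OF one_closed] .
  have c: "e \<in> carrier R" "d \<in> carrier R" using ed E_carrier D_carrier by auto
  have "e \<oplus> \<zero> = (e \<oplus> d) \<otimes> e" unfolding ed(3)[symmetric] using c by simp
  hence ee: "e \<oplus> \<zero> = e \<otimes> e \<oplus> d \<otimes> e" using c by (simp add: l_distr)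
  have "e = e \<otimes> e"
    by (rule even_component_unique[OF ed(1) D_additive(1) even_even[OF ed(1,1)] odd_even[OF ed(2,1)] ee])
  hence "e \<oplus> \<zero> = e \<oplus> d \<otimes> e" using ee by simp
  hence "d \<otimes> e = \<zero>" using add.l_cancel[of e \<zero> "d \<otimes> e"] c by simp
  hence "e \<otimes> d = \<zero>" using even_central[OF ed(1) c(2)] by simp
  moreover have "d = (e \<oplus> d) \<otimes> d" unfolding ed(3)[symmetric] using c by simp
  hence "d = e \<otimes> d \<oplus> d \<otimes> d" using c by (simp add: l_distr)
  ultimately have "d = \<zero>" using odd_square[OF ed(2)] by simp
  thus ?thesis using ed c by simp
qed

lemma E_subring: "subring E R"
  by (rule subringI) (use E_carrier one_even E_additive even_even in auto)

lemma E_cring: "cring (R\<lparr>carrier := E\<rparr>)"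
proof -
  have "subcring E R"
    by (rule subcringI[OF E_subring]) (use even_central E_carrier in blast)
  thus ?thesis using subcring_iff[OF E_carrier] by simp
qed

lemma subring_E_iff: "subring B (R\<lparr>carrier := E\<rparr>) \<longleftrightarrow> subring B R \<and> B \<subseteq> E"
proof -
  interpret S: cring "R\<lparr>carrier := E\<rparr>" by (rule E_cring)
  have "subring B (R\<lparr>carrier := E\<rparr>) \<longleftrightarrow> B \<subseteq> E \<and> subring B (R\<lparr>carrier := E\<rparr>)"
    using subringE(1)[of B "R\<lparr>carrier := E\<rparr>"] by auto
  also have "\<dots> \<longleftrightarrow> B \<subseteq> E \<and> ring (R\<lparr>carrier := B\<rparr>)"
    using S.subring_iff[of B] by auto
  also have "\<dots> \<longleftrightarrow> subring B R \<and> B \<subseteq> E"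
    using subring_iff[of B] E_carrier by auto
  finally show ?thesis .
qed

lemma D_subset_odd_ideal: "D \<subseteq> odd_ideal R D"
proof
  fix d assume d: "d \<in> D"
  have "\<one> \<otimes> d \<in> odd_ideal R D" unfolding odd_ideal_def by (rule ideal_prod.prod) (use d in auto)
  thus "d \<in> odd_ideal R D" using d D_carrier by auto
qed

lemma superring_pair_components:
  assumes "superring_pair R E D A p"
  shows "subring A R" "prime_ideal_of R A p" "D \<subseteq> p" "p \<subseteq> A"
proof -
  show A: "subring A R" "prime_ideal_of R A p"
    using assms unfolding superring_pair_def subsuperring_def by auto
  show "D \<subseteq> p" using assms D_subset_odd_ideal unfolding superring_pair_def by auto
  show "p \<subseteq> A" by (rule prime_ideal_ofD(1)[OF A])
qed

lemma even_component_mem: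
  assumes M: "D \<subseteq> M" "\<And>x y. x \<in> M \<Longrightarrow> y \<in> M \<Longrightarrow> x \<oplus> y \<in> M" and ed: "e \<in> E" "d \<in> D" "e \<oplus> d \<in> M"
  shows "e \<in> M"
proof -
  have c: "e \<in> carrier R" "d \<in> carrier R" using ed E_carrier D_carrier by auto
  have "(e \<oplus> d) \<oplus> \<ominus> d \<in> M" using M(2)[OF ed(3) subsetD[OF M(1) D_additive(3)[OF ed(2)]]] .
  moreover have "(e \<oplus> d) \<oplus> \<ominus> d = e" using c by algebra
  ultimately show ?thesis by simp
qed

text \<open>Modulo \<open>q + D\<close> the product \<open>(b + d) (b' + d')\<close> is \<open>b b'\<close>, since \<open>d d' \<in> q\<close>; so the quotient of
  \<open>B + D\<close> by \<open>q + D\<close> is that of \<open>B\<close> by \<open>q\<close>, a commutative domain. The hypothesis on products of odd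
  elements also makes \<open>B + D\<close> closed under multiplication and \<open>q + D\<close> large enough to contain
  the ideal generated by \<open>D\<close>.\<close>

lemma superring_pair_even_plus_odd:
  assumes B: "subring B R" "B \<subseteq> E" and q: "prime_ideal_of R B q"
    and DD: "\<And>d d'. d \<in> D \<Longrightarrow> d' \<in> D \<Longrightarrow> d \<otimes> d' \<in> q"
  shows "superring_pair R E D (B <+>\<^bsub>R\<^esub> D) (q <+>\<^bsub>R\<^esub> D)"
proof -
  let ?B = "B <+>\<^bsub>R\<^esub> D" and ?q = "q <+>\<^bsub>R\<^esub> D"
  note qD = prime_ideal_ofD[OF B(1) q]
  note qB = qD(1) and q0 = qD(2) and q1 = qD(3) and qadd = qD(4) and ql = qD(5) and qr = qD(6)
    and qprime = qD(7) and qneg = qD(8)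
  have Bc: "B \<subseteq> carrier R" and B0: "\<zero> \<in> B" and B1: "\<one> \<in> B"
    using subringE(1-3)[OF B(1)] by auto
  note Bcl = subringE(5-7)[OF B(1)]
  have mem: "b \<oplus> d \<in> M <+>\<^bsub>R\<^esub> D" if "b \<in> M" "d \<in> D" for b d M
    using that unfolding set_add_def' by blast
  have memE: "\<exists>b\<in>M. \<exists>d\<in>D. x = b \<oplus> d" if "x \<in> M <+>\<^bsub>R\<^esub> D" for x M
    using that unfolding set_add_def' by blast
  have add: "(b \<oplus> d) \<oplus> (b' \<oplus> d') = (b \<oplus> b') \<oplus> (d \<oplus> d')"
    if "b \<in> B" "b' \<in> B" "d \<in> D" "d' \<in> D" for b b' d d'
  proof -
    have "b \<in> carrier R" "b' \<in> carrier R" "d \<in> carrier R" "d' \<in> carrier R"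
      using that Bc D_carrier by auto
    thus ?thesis by algebra
  qed
  have mult: "(b \<oplus> d) \<otimes> (b' \<oplus> d') = (b \<otimes> b' \<oplus> d \<otimes> d') \<oplus> (b \<otimes> d' \<oplus> d \<otimes> b')"
    "b \<otimes> d' \<oplus> d \<otimes> b' \<in> D"
    if "b \<in> B" "b' \<in> B" "d \<in> D" "d' \<in> D" for b b' d d'
  proof -
    have "b \<in> carrier R" "b' \<in> carrier R" "d \<in> carrier R" "d' \<in> carrier R"
      using that Bc D_carrier by auto
    thus "(b \<oplus> d) \<otimes> (b' \<oplus> d') = (b \<otimes> b' \<oplus> d \<otimes> d') \<oplus> (b \<otimes> d' \<oplus> d \<otimes> b')" by algebra
    show "b \<otimes> d' \<oplus> d \<otimes> b' \<in> D" 
      by (rule D_additive(2)[OF even_odd odd_even]) (use that B(2) in auto)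
  qed
  have even_q: "b \<in> q" if bd: "b \<oplus> d \<in> ?q" "b \<in> B" "d \<in> D" for b d
  proof -
    obtain b' d' where b': "b' \<in> q" "d' \<in> D" "b \<oplus> d = b' \<oplus> d'" using memE[OF bd(1)] by blast
    have "b = b'" by (rule even_component_unique[OF _ bd(3) _ b'(2,3)]) (use bd b' qB B(2) in auto)
    thus ?thesis using b'(1) by simp
  qed
  have Bsub: "subring ?B R"
  proof (rule subringI)
    show "?B \<subseteq> carrier R" unfolding set_add_def' using Bc D_carrier by auto
    show "\<one> \<in> ?B" using mem[OF B1 D_additive(1)] by simp
  next
    fix x assume "x \<in> ?B"
    then obtain b d where bd: "b \<in> B" "d \<in> D" "x = b \<oplus> d" using memE by blast
    have "\<ominus> x = \<ominus> b \<oplus> \<ominus> d" 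
      unfolding bd(3) by (rule minus_add) (use bd Bc D_carrier in auto)
    thus "\<ominus> x \<in> ?B" using mem bd Bcl(1) D_additive(3) by simp
  next
    fix x y assume "x \<in> ?B" "y \<in> ?B"
    then obtain b d b' d' where bd: "b \<in> B" "d \<in> D" "x = b \<oplus> d" "b' \<in> B" "d' \<in> D" "y = b' \<oplus> d'"
      using memE by meson
    show "x \<otimes> y \<in> ?B"
      unfolding bd(3,6) mult(1)[OF bd(1,4,2,5)]
      by (rule mem[OF Bcl(3)[OF Bcl(2) subsetD[OF qB DD]] mult(2)]) (use bd in auto)
    show "x \<oplus> y \<in> ?B"
      unfolding bd(3,6) add[OF bd(1,4,2,5)]
      by (rule mem[OF Bcl(3) D_additive(2)]) (use bd in auto)
  qed
  have Dq: "D \<subseteq> ?q"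
  proof
    fix d assume "d \<in> D"
    thus "d \<in> ?q" using mem[OF q0, of d] D_carrier by auto
  qed
  have qadd': "x \<oplus> y \<in> ?q" if xy: "x \<in> ?q" "y \<in> ?q" for x y
  proof -
    obtain b d b' d' where bd: "b \<in> q" "d \<in> D" "x = b \<oplus> d" "b' \<in> q" "d' \<in> D" "y = b' \<oplus> d'"
      using xy memE by meson
    have "(b \<oplus> b') \<oplus> (d \<oplus> d') \<in> ?q" by (rule mem[OF qadd D_additive(2)]) (use bd in auto)
    thus ?thesis
      unfolding bd(3,6) add[OF subsetD[OF qB bd(1)] subsetD[OF qB bd(4)] bd(2,5)] .
  qed
  have prime: "prime_ideal_of R ?B ?q"
    unfolding prime_ideal_of_iff[OF Bsub]
  proof (intro conjI ballI impI)
    show "?q \<subseteq> ?B" unfolding set_add_def' using qB by blast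
    show "\<zero> \<in> ?q" using mem[OF q0 D_additive(1)] by simp
    show "x \<oplus> y \<in> ?q" if "x \<in> ?q" "y \<in> ?q" for x y by (rule qadd'[OF that])
    show "\<one> \<notin> ?q"
    proof
      assume "\<one> \<in> ?q"
      hence "\<one> \<oplus> \<zero> \<in> ?q" by simp
      thus False using even_q[OF _ B1 D_additive(1)] q1 by blast
    qed
  next
    fix x y assume "x \<in> ?B" "y \<in> ?q"
    then obtain b d b' d' where bd: "b \<in> B" "d \<in> D" "x = b \<oplus> d" "b' \<in> q" "d' \<in> D" "y = b' \<oplus> d'"
      using memE by meson
    have b': "b' \<in> B" using bd qB by auto
    show "x \<otimes> y \<in> ?q"
      unfolding bd(3,6) mult(1)[OF bd(1) b' bd(2,5)]
      by (rule mem[OF qadd[OF ql DD] mult(2)]) (use bd b' in auto)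
    show "y \<otimes> x \<in> ?q"
      unfolding bd(3,6) mult(1)[OF b' bd(1) bd(5,2)]
      by (rule mem[OF qadd[OF qr DD] mult(2)]) (use bd b' in auto)
  next
    fix x y assume "x \<in> ?B" "y \<in> ?B"
    then obtain b d b' d' where bd: "b \<in> B" "d \<in> D" "x = b \<oplus> d" "b' \<in> B" "d' \<in> D" "y = b' \<oplus> d'"
      using memE by meson
    have c: "b \<in> carrier R" "b' \<in> carrier R" "d \<in> carrier R" "d' \<in> carrier R"
      using bd Bc D_carrier by auto
    have comm: "b \<otimes> b' = b' \<otimes> b" "b \<otimes> d' = d' \<otimes> b" "d \<otimes> b' = b' \<otimes> d"
      using even_central bd(1,4) B(2) c by force+
    have "x \<otimes> y \<ominus> y \<otimes> x =
      (b \<otimes> b' \<oplus> d \<otimes> d' \<oplus> (b \<otimes> d' \<oplus> d \<otimes> b')) \<ominus> (b' \<otimes> b \<oplus> d' \<otimes> d \<oplus> (b' \<otimes> d \<oplus> d' \<otimes> b))"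
      unfolding bd(3,6) using c by algebra
    also have "\<dots> = (d \<otimes> d' \<oplus> \<ominus> (d' \<otimes> d)) \<oplus> \<zero>"
      unfolding comm using c by algebra
    finally show "x \<otimes> y \<ominus> y \<otimes> x \<in> ?q"
      using mem[OF qadd[OF DD[OF bd(2,5)] qneg[OF DD[OF bd(5,2)]]] D_additive(1)] by simp
    assume "x \<otimes> y \<in> ?q"
    hence "b \<otimes> b' \<oplus> d \<otimes> d' \<oplus> (b \<otimes> d' \<oplus> d \<otimes> b') \<in> ?q"
      unfolding bd(3,6) mult(1)[OF bd(1,4,2,5)] .
    hence "b \<otimes> b' \<oplus> d \<otimes> d' \<in> q"
      by (rule even_q[OF _ Bcl(3)[OF Bcl(2)[OF bd(1,4)] subsetD[OF qB DD[OF bd(2,5)]]]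
            mult(2)[OF bd(1,4,2,5)]])
    hence "(b \<otimes> b' \<oplus> d \<otimes> d') \<oplus> \<ominus> (d \<otimes> d') \<in> q"
      by (rule qadd[OF _ qneg[OF DD[OF bd(2,5)]]])
    moreover have "(b \<otimes> b' \<oplus> d \<otimes> d') \<oplus> \<ominus> (d \<otimes> d') = b \<otimes> b'" using c by algebra
    ultimately have "b \<in> q \<or> b' \<in> q" using qprime bd by simp
    thus "x \<in> ?q \<or> y \<in> ?q" using mem bd by blast
  qed
  have graded: "?B = (?B \<inter> E) <+>\<^bsub>R\<^esub> (?B \<inter> D)"
  proof (intro equalityI subsetI)
    fix x assume "x \<in> ?B"
    then obtain b d where bd: "b \<in> B" "d \<in> D" "x = b \<oplus> d" using memE by blast
    have "b \<in> ?B" using mem[OF bd(1) D_additive(1)] bd Bc by auto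
    moreover have "d \<in> ?B" using mem[OF B0 bd(2)] bd D_carrier by auto
    ultimately show "x \<in> (?B \<inter> E) <+>\<^bsub>R\<^esub> (?B \<inter> D)"
      using bd B(2) unfolding set_add_def'[of _ "?B \<inter> E"] by blast
  next
    fix x assume "x \<in> (?B \<inter> E) <+>\<^bsub>R\<^esub> (?B \<inter> D)"
    then obtain u v where "u \<in> ?B" "v \<in> ?B" "x = u \<oplus> v"
      unfolding set_add_def'[of _ "?B \<inter> E"] by blast
    thus "x \<in> ?B" using subringE(7)[OF Bsub] by simp
  qed
  have "odd_ideal R D \<subseteq> ?q"
  proof
    fix x assume "x \<in> odd_ideal R D"
    thus "x \<in> ?q" unfolding odd_ideal_def
    proof (induction rule: ideal_prod.induct)
      case (prod u d)
      obtain e d' where ed: "e \<in> E" "d' \<in> D" "u = e \<oplus> d'" using E_D_decomposition[OF prod(1)] .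
      have c: "e \<in> carrier R" "d' \<in> carrier R" "d \<in> carrier R"
        using ed prod(2) E_carrier D_carrier by auto
      have "u \<otimes> d = d' \<otimes> d \<oplus> e \<otimes> d" unfolding ed using c by algebra
      thus ?case using mem[OF DD[OF ed(2) prod(2)] even_odd[OF ed(1) prod(2)]] by simp
    next
      case (sum s1 s2)
      show ?case by (rule qadd'[OF sum.IH])
    qed
  qed
  thus ?thesis using Bsub graded prime unfolding superring_pair_def subsuperring_def by blast
qed

text \<open>A larger pair \<open>(B, q)\<close> in \<open>E\<close> yields the larger pair \<open>(B + D, q + D)\<close> in \<open>R\<close>: the products of odd
  elements lie in \<open>p \<inter> E \<subseteq> q\<close>. So \<open>B + D = A\<close>, whence \<open>B = A \<inter> E\<close>.\<close>

lemma even_part_maximal: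
  assumes max: "maximal_pair R E D A p"
  shows "maximal_prime_pair (R\<lparr>carrier := E\<rparr>) (A \<inter> E) (p \<inter> E)"
proof -
  have pair: "superring_pair R E D A p" using max unfolding maximal_pair_def by blast
  note A = superring_pair_components[OF pair]
  have AE: "subring (A \<inter> E) R" by (rule subring_inter[OF A(1) E_subring])
  note pD = prime_ideal_ofD[OF A(1,2)]
  have pE: "prime_ideal_of R (A \<inter> E) (p \<inter> E)"
    unfolding prime_ideal_of_iff[OF AE]
  proof (intro conjI ballI impI)
    fix x y assume xy: "x \<in> A \<inter> E" "y \<in> A \<inter> E"
    show "x \<otimes> y \<ominus> y \<otimes> x \<in> p \<inter> E"
      using pD(9)[of x y] xy even_even E_additive by (simp add: a_minus_def)
    show "x \<in> p \<inter> E \<or> y \<in> p \<inter> E" if "x \<otimes> y \<in> p \<inter> E" using pD(7)[of x y] xy that by simp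
  qed (use pD(1-6) E_additive even_even in auto)
  interpret S: cring "R\<lparr>carrier := E\<rparr>" by (rule E_cring)
  show ?thesis
  proof (intro maximal_prime_pair.intro prime_pair.intro prime_pair_axioms.intro
      maximal_prime_pair_axioms.intro E_cring)
    show "subring (A \<inter> E) (R\<lparr>carrier := E\<rparr>)" using AE subring_E_iff by auto
    show "prime_ideal_of (R\<lparr>carrier := E\<rparr>) (A \<inter> E) (p \<inter> E)"
      using pE by (simp add: prime_ideal_of_def)
    fix B q
    assume "subring B (R\<lparr>carrier := E\<rparr>)" "prime_ideal_of (R\<lparr>carrier := E\<rparr>) B q"
      and AB: "A \<inter> E \<subseteq> B" and pq: "p \<inter> E = A \<inter> E \<inter> q"
    hence B: "subring B R" "B \<subseteq> E" and q: "prime_ideal_of R B q"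
      using subring_E_iff by (auto simp: prime_ideal_of_def)
    let ?B = "B <+>\<^bsub>R\<^esub> D" and ?q = "q <+>\<^bsub>R\<^esub> D"
    have qB: "q \<subseteq> B" by (rule prime_ideal_ofD(1)[OF B(1) q])
    have DD: "d \<otimes> d' \<in> q" if "d \<in> D" "d' \<in> D" for d d'
    proof -
      have "d \<otimes> d' \<in> p \<inter> E" using pD(5)[of d d'] that A(3,4) odd_odd by auto
      thus ?thesis using pq by blast
    qed
    have pair': "superring_pair R E D ?B ?q" by (rule superring_pair_even_plus_odd[OF B q DD])
    have dec: "\<exists>e\<in>M \<inter> E. \<exists>d\<in>D. x = e \<oplus> d"
      if x: "x \<in> M" and M: "D \<subseteq> M" "M \<subseteq> carrier R" "\<And>x y. x \<in> M \<Longrightarrow> y \<in> M \<Longrightarrow> x \<oplus> y \<in> M"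
      for x M
    proof -
      obtain e d where ed: "e \<in> E" "d \<in> D" "x = e \<oplus> d" using E_D_decomposition x M(2) by blast
      have "e \<in> M" by (rule even_component_mem[OF M(1,3) ed(1,2)]) (use x ed in simp_all)
      thus ?thesis using ed by blast
    qed
    have Ac: "A \<subseteq> carrier R" and Aadd: "\<And>x y. x \<in> A \<Longrightarrow> y \<in> A \<Longrightarrow> x \<oplus> y \<in> A"
      using subringE(1,7)[OF A(1)] by auto
    note padd = pD(4)
    have DA: "D \<subseteq> A" using A(3,4) by blast
    have "pair_le A p ?B ?q"
      unfolding pair_le_def
    proof (intro conjI equalityI subsetI)
      fix x assume "x \<in> A"
      thus "x \<in> ?B" using dec[OF _ DA Ac Aadd, of x] AB unfolding set_add_def' by blast
    next
      fix x assume x: "x \<in> p"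
      have "x \<in> ?q" using dec[OF x A(3) subset_trans[OF A(4) Ac] padd] pq unfolding set_add_def' by blast
      thus "x \<in> A \<inter> ?q" using x A(4) by blast
    next
      fix x assume x: "x \<in> A \<inter> ?q"
      then obtain e d where ed: "e \<in> q" "d \<in> D" "x = e \<oplus> d" unfolding set_add_def' by blast
      have "e \<in> E" using ed qB B(2) by blast
      moreover have "e \<in> A"
        by (rule even_component_mem[OF DA Aadd \<open>e \<in> E\<close> ed(2)]) (use x ed in simp_all)
      ultimately have "e \<in> p" using ed pq by blast
      thus "x \<in> p" unfolding ed(3) using padd ed(2) A(3) by blast
    qed
    hence BA: "?B = A" using max pair' unfolding maximal_pair_def by blast
    have "B \<subseteq> A"
    proof
      fix b assume b: "b \<in> B"
      have "b \<oplus> \<zero> \<in> ?B" using b D_additive(1) unfolding set_add_def' by blast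
      thus "b \<in> A" using b B(2) E_carrier BA by auto
    qed
    thus "B = A \<inter> E" using AB B(2) by blast
  qed
qed

lemma valuation_imp_maximal:
  assumes val: "valuation_pair R E D A p"
  shows "maximal_pair R E D A p"
  unfolding maximal_pair_def
proof (intro conjI allI impI)
  show "superring_pair R E D A p" using val unfolding valuation_pair_def by blast
  fix B q assume B: "superring_pair R E D B q" and le: "pair_le A p B q"
  note Bq = superring_pair_components[OF B]
  have AB: "A \<subseteq> B" and p: "p = A \<inter> q" using le unfolding pair_le_def by auto
  have "B \<subseteq> A"
  proof (rule subsetI, rule ccontr)
    fix x assume x: "x \<in> B" "x \<notin> A"
    hence "x \<in> carrier R - A" using subringE(1)[OF Bq(1)] by blast
    then obtain a where a: "a \<in> p" "x \<otimes> a \<in> A - p" using val unfolding valuation_pair_def by blast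
    have "x \<otimes> a \<in> q" using prime_ideal_ofD(5)[OF Bq(1,2) x(1)] a(1) p by blast
    thus False using a(2) p by blast
  qed
  thus "B = A" using AB by blast
  thus "q = p" using Bq(4) p by blast
qed

text \<open>For \<open>x = e + d\<close> outside \<open>A\<close> the even component \<open>e\<close> is outside \<open>A\<close> as well, and an even multiplier
  \<open>a\<close> that works for \<open>e\<close> works for \<open>x\<close>, since \<open>d a \<in> D \<subseteq> p\<close>.\<close>

lemma maximal_imp_valuation:
  assumes max: "maximal_pair R E D A p"
  shows "valuation_pair R E D A p"
proof -
  have pair: "superring_pair R E D A p" using max unfolding maximal_pair_def by blast
  note A = superring_pair_components[OF pair]
  note pD = prime_ideal_ofD[OF A(1,2)]
  have "\<exists>a\<in>p \<inter> (A \<inter> E). x \<otimes> a \<in> A - p" if x: "x \<in> carrier R - A" for x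
  proof -
    obtain e d where ed: "e \<in> E" "d \<in> D" "x = e \<oplus> d" using E_D_decomposition x by blast
    have "e \<notin> A" using x ed A(3,4) subringE(7)[OF A(1)] by blast
    then obtain a where a: "a \<in> p \<inter> E" "e \<otimes> a \<in> (A \<inter> E) - (p \<inter> E)"
      using maximal_prime_pair.valuation_property[OF even_part_maximal[OF max], of e] ed(1) by auto
    have c: "e \<in> carrier R" "d \<in> carrier R" "a \<in> carrier R" using ed a E_carrier D_carrier by auto
    have da: "d \<otimes> a \<in> D" using odd_even ed a by blast
    have eq: "x \<otimes> a = e \<otimes> a \<oplus> d \<otimes> a" unfolding ed using c by algebra
    have "x \<otimes> a \<in> A" unfolding eq using a da A(3,4) subringE(7)[OF A(1)] by blast
    moreover have "x \<otimes> a \<notin> p"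
    proof
      assume "x \<otimes> a \<in> p"
      hence "e \<otimes> a \<in> p"
        by (intro even_component_mem[OF A(3), of "e \<otimes> a" "d \<otimes> a"]) (use pD(4) a da eq ed even_even in auto)
      thus False using a by blast
    qed
    ultimately show ?thesis using a A(4) by blast
  qed
  thus ?thesis using pair unfolding valuation_pair_def by blast
qed

end

theorem proposition2p8:
  fixes R :: "('a, 'b) ring_scheme" and E D A p :: "'a set"
  assumes "superring R E D"
    and "superring_pair R E D A p"
  shows "valuation_pair R E D A p \<longleftrightarrow> maximal_pair R E D A p"
  using superring.valuation_imp_maximal[OF assms(1)] superring.maximal_imp_valuation[OF assms(1)]
  by blast

end
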